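(* Let $N\ge1$, $d\ge2$, $\boldsymbol p=(p_1,\dots,p_d)$ with $p_j>0$, $\sum_jp_j=1$, and let $\rho_1,\dots,\rho_N$ be real numbers. Then $$m(\boldsymbol x;N,\boldsymbol p)\,m(\boldsymbol y;N,\boldsymbol p)\Big\{1+\sum_{n=1}^N\rho_nQ_n(\boldsymbol x,\boldsymbol y;N,\boldsymbol p)\Big\}\ge0$$ for all $\boldsymbol x,\boldsymbol y\in\mathbb Z_+^d$ with $|\boldsymbol x|=|\boldsymbol y|=N$ if and only if there exist $p$ with $1-\min_{j\in\{1,\dots,d\}}p_j\le p\le1$ and a random variable $Z$ on $\{0,1,\dots,N\}$ such that $$\rho_n=\mathbb E\big[Q_n(Z;N,p)\big],\qquad n=1,\dots,N,$$ where $Q_n(\cdot;N,p)$ are the one-dimensional Krawtchouk polynomials and $Q_n(\boldsymbol x,\boldsymbol y;N,\boldsymbol p)$ the reproducing kernel polynomials on the multinomial $(N,\boldsymbol p)$ distribution.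
   Context: $|\boldsymbol x|=\sum_jx_j$; $m(\boldsymbol x;N,\boldsymbol p)=\frac{N!}{\prod_jx_j!}\prod_jp_j^{x_j}$. One-dimensional Krawtchouk polynomials: $Q_n(x;N,p)=\sum_\nu(-q/p)^\nu\binom x\nu\binom{N-x}{n-\nu}/\binom Nn$, $q=1-p$, with $0^0=1$. Reproducing kernel polynomials: choose real functions $u^{(0)}\equiv1,u^{(1)},\dots,u^{(d-1)}$ on $\{1,\dots,d\}$ with $\sum_{j=1}^du^{(k)}_ju^{(l)}_jp_j=\delta_{kl}$. For $\boldsymbol n\in\mathbb Z_+^{d-1}$, $|\boldsymbol n|\le N$, let $Q_{\boldsymbol n}(\boldsymbol x;\boldsymbol u)$ be the coefficient of $w_1^{n_1}\cdots w_{d-1}^{n_{d-1}}$ in $\prod_{j=1}^d\big(1+\sum_{l=1}^{d-1}w_lu^{(l)}_j\big)^{x_j}$. These are orthogonal on the multinomial with squared norm $\frac{N!}{n_1!\cdots n_{d-1}!(N-|\boldsymbol n|)!}$; let $Q^\circ_{\boldsymbol n}$ be their unit-norm scalings. Then $Q_n(\boldsymbol x,\boldsymbol y;N,\boldsymbol p)=\sum_{|\boldsymbol n|=n}Q^\circ_{\boldsymbol n}(\boldsymbol x;\boldsymbol u)Q^\circ_{\boldsymbol n}(\boldsymbol y;\boldsymbol u)$, independent of the choice of $\boldsymbol u$. *)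

theory Defs
  imports "HOL-Library.Poly_Mapping" "HOL-Probability.Probability"
begin

(* Vectors in Z_+^k, with coordinates numbered 1, ..., k, are finitely supported functions
   vanishing off {1..k}, so that they also serve as exponents of monomials. *)
definition weak_compositions :: "nat \<Rightarrow> nat \<Rightarrow> (nat \<Rightarrow>\<^sub>0 nat) set" where
  "weak_compositions k n = {x. Poly_Mapping.keys x \<subseteq> {1..k} \<and> (\<Sum>j=1..k. Poly_Mapping.lookup x j) = n}"

definition multinomial :: "nat \<Rightarrow> nat \<Rightarrow> (nat \<Rightarrow> real) \<Rightarrow> (nat \<Rightarrow>\<^sub>0 nat) \<Rightarrow> real" where
  "multinomial d N p x =
     fact N / (\<Prod>j=1..d. fact (Poly_Mapping.lookup x j)) * (\<Prod>j=1..d. p j ^ Poly_Mapping.lookup x j)"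

(* Intended for x \<le> N. Terms with \<nu> > n vanish by the usual binomial convention and are left
   out, because truncated subtraction would give (N - x) choose (n - \<nu>) = 1 for them. *)
definition krawtchouk :: "nat \<Rightarrow> nat \<Rightarrow> nat \<Rightarrow> real \<Rightarrow> real" where
  "krawtchouk n x N p =
     (\<Sum>\<nu>=0..n. (- ((1 - p) / p)) ^ \<nu> * real (x choose \<nu>) * real ((N - x) choose (n - \<nu>)))
       / real (N choose n)"

(* u l j is the value at j of the l-th function. *)
definition orthonormal_functions :: "nat \<Rightarrow> (nat \<Rightarrow> real) \<Rightarrow> (nat \<Rightarrow> nat \<Rightarrow> real) \<Rightarrow> bool" where
  "orthonormal_functions d p u \<longleftrightarrow>
     (\<forall>j\<in>{1..d}. u 0 j = 1) \<and>
     (\<forall>k\<in>{0..d-1}. \<forall>l\<in>{0..d-1}. (\<Sum>j=1..d. u k j * u l j * p j) = (if k = l then 1 else 0))"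

(* Polynomials in the indeterminates w_1, w_2, ... are finitely supported functions from
   exponents to coefficients; w_l is the monomial with exponent single l 1. *)
definition mv_gen_fun ::
    "nat \<Rightarrow> (nat \<Rightarrow> nat \<Rightarrow> real) \<Rightarrow> (nat \<Rightarrow>\<^sub>0 nat) \<Rightarrow> ((nat \<Rightarrow>\<^sub>0 nat) \<Rightarrow>\<^sub>0 real)" where
  "mv_gen_fun d u x =
     (\<Prod>j=1..d. (1 + (\<Sum>l=1..d-1. Poly_Mapping.single (Poly_Mapping.single l 1) (u l j)))
        ^ Poly_Mapping.lookup x j)"

definition mv_krawtchouk ::
    "nat \<Rightarrow> (nat \<Rightarrow> nat \<Rightarrow> real) \<Rightarrow> (nat \<Rightarrow>\<^sub>0 nat) \<Rightarrow> (nat \<Rightarrow>\<^sub>0 nat) \<Rightarrow> real" where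
  "mv_krawtchouk d u n x = Poly_Mapping.lookup (mv_gen_fun d u x) n"

definition mv_krawtchouk_unit ::
    "nat \<Rightarrow> nat \<Rightarrow> (nat \<Rightarrow> real) \<Rightarrow> (nat \<Rightarrow> nat \<Rightarrow> real) \<Rightarrow> (nat \<Rightarrow>\<^sub>0 nat) \<Rightarrow> (nat \<Rightarrow>\<^sub>0 nat) \<Rightarrow> real" where
  "mv_krawtchouk_unit d N p u n x =
     mv_krawtchouk d u n x /
       sqrt (\<Sum>z\<in>weak_compositions d N. multinomial d N p z * (mv_krawtchouk d u n z)\<^sup>2)"

definition kernel_poly ::
    "nat \<Rightarrow> nat \<Rightarrow> (nat \<Rightarrow> real) \<Rightarrow> (nat \<Rightarrow> nat \<Rightarrow> real) \<Rightarrow>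
       nat \<Rightarrow> (nat \<Rightarrow>\<^sub>0 nat) \<Rightarrow> (nat \<Rightarrow>\<^sub>0 nat) \<Rightarrow> real" where
  "kernel_poly d N p u n x y =
     (\<Sum>k\<in>weak_compositions (d - 1) n. mv_krawtchouk_unit d N p u k x * mv_krawtchouk_unit d N p u k y)"

lemma finite_weak_compositions: "finite (weak_compositions k n)"
proof -
  have "weak_compositions k n \<subseteq> {x. Poly_Mapping.lookup x \<in> {f. \<forall>j. (j \<in> {1..k} \<longrightarrow> f j \<in> {0..n}) \<and> (j \<notin> {1..k} \<longrightarrow> f j = 0)}}"
  proof
    fix x assume x: "x \<in> weak_compositions k n"
    then have s: "(\<Sum>j=1..k. Poly_Mapping.lookup x j) = n" and ks: "Poly_Mapping.keys x \<subseteq> {1..k}"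
      by (auto simp: weak_compositions_def)
    have "Poly_Mapping.lookup x j \<le> n" if "j \<in> {1..k}" for j
      using member_le_sum[of j "{1..k}" "Poly_Mapping.lookup x"] that s by auto
    moreover have "Poly_Mapping.lookup x j = 0" if "j \<notin> {1..k}" for j
      using that ks by (meson in_keys_iff subsetD)
    ultimately show "x \<in> {x. Poly_Mapping.lookup x \<in> {f. \<forall>j. (j \<in> {1..k} \<longrightarrow> f j \<in> {0..n}) \<and> (j \<notin> {1..k} \<longrightarrow> f j = 0)}}"
      by auto
  qed
  moreover have "finite {f::nat \<Rightarrow> nat. \<forall>j. (j \<in> {1..k} \<longrightarrow> f j \<in> {0..n}) \<and> (j \<notin> {1..k} \<longrightarrow> f j = 0)}"
    by (rule finite_set_of_finite_funs) auto
  then have "finite (Poly_Mapping.lookup -` {f. \<forall>j. (j \<in> {1..k} \<longrightarrow> f j \<in> {0..n}) \<and> (j \<notin> {1..k} \<longrightarrow> f j = 0)})"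
    by (rule finite_vimageI) (simp add: inj_on_def poly_mapping_eqI)
  then have "finite {x. Poly_Mapping.lookup x \<in> {f. \<forall>j. (j \<in> {1..k} \<longrightarrow> f j \<in> {0..n}) \<and> (j \<notin> {1..k} \<longrightarrow> f j = 0)}}"
    by (simp add: vimage_def)
  ultimately show ?thesis
    by (rule finite_subset)
qed

lemma orthonormal_functions_exist:
  fixes d :: nat and p :: "nat \<Rightarrow> real"
  assumes pos: "\<And>j. j \<in> {1..d} \<Longrightarrow> p j > 0" and sum1: "(\<Sum>j=1..d. p j) = 1"
  shows "\<exists>u. orthonormal_functions d p u"
proof -
  define S where "S l = (\<Sum>j=1..l. p j)" for l
  define u where "u l j = (if l = 0 then 1 else if j \<le> l then sqrt (p (Suc l) / (S l * S (Suc l)))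
      else if j = Suc l then - sqrt (S l / (p (Suc l) * S (Suc l))) else 0)" for l j :: nat
  have Spos: "S l > 0" if "1 \<le> l" "l \<le> d" for l
    unfolding S_def using that by (intro sum_pos) (auto intro: pos)
  have S_Suc: "S (Suc l) = S l + p (Suc l)" for l
    by (simp add: S_def)
  have split: "(\<Sum>j=1..d. f j) = (\<Sum>j=1..l. f j) + f (Suc l)"
    if "1 \<le> l" "l < d" "\<And>j. j > Suc l \<Longrightarrow> f j = 0" for l and f :: "nat \<Rightarrow> real"
  proof -
    have "(\<Sum>j=1..d. f j) = (\<Sum>j=1..Suc l. f j)"
      using that by (intro sum.mono_neutral_right) auto
    then show ?thesis by simp
  qed
  have zero: "(\<Sum>j=1..d. c j * u l j * p j) = 0"
    if l: "1 \<le> l" "l < d" and c: "\<And>j. j \<in> {1..Suc l} \<Longrightarrow> c j = K" for l c K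
  proof -
    have P: "p (Suc l) > 0" "S l > 0" "S (Suc l) > 0" using l pos Spos by auto
    have "(\<Sum>j=1..d. c j * u l j * p j) = (\<Sum>j=1..l. c j * u l j * p j) + c (Suc l) * u l (Suc l) * p (Suc l)"
      using l by (intro split) (auto simp: u_def)
    also have "(\<Sum>j=1..l. c j * u l j * p j) = (\<Sum>j=1..l. K * sqrt (p (Suc l) / (S l * S (Suc l))) * p j)"
      using l c by (intro sum.cong) (auto simp: u_def)
    also have "\<dots> = K * sqrt (p (Suc l) / (S l * S (Suc l))) * S l"
      by (simp add: S_def sum_distrib_left)
    also have "c (Suc l) * u l (Suc l) * p (Suc l) = - K * sqrt (S l / (p (Suc l) * S (Suc l))) * p (Suc l)"
      using l c by (auto simp: u_def)
    finally have *: "(\<Sum>j=1..d. c j * u l j * p j) = K * (sqrt (p (Suc l) / (S l * S (Suc l))) * S l)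
        - K * (sqrt (S l / (p (Suc l) * S (Suc l))) * p (Suc l))"
      by simp
    have "sqrt (p (Suc l) / (S l * S (Suc l))) * S l = sqrt (p (Suc l) / S (Suc l)) * (S l / sqrt (S l))"
      by (simp add: real_sqrt_divide real_sqrt_mult)
    also have "\<dots> = sqrt (p (Suc l) / S (Suc l)) * sqrt (S l)"
      using P by (simp add: real_div_sqrt)
    also have "\<dots> = sqrt (S l / S (Suc l)) * (p (Suc l) / sqrt (p (Suc l)))"
      using P by (simp add: real_sqrt_divide real_div_sqrt)
    also have "\<dots> = sqrt (S l / (p (Suc l) * S (Suc l))) * p (Suc l)"
      by (simp add: real_sqrt_divide real_sqrt_mult)
    finally show ?thesis using * by simp
  qed
  have one: "(\<Sum>j=1..d. u l j * u l j * p j) = 1" if l: "1 \<le> l" "l < d" for l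
  proof -
    have P: "p (Suc l) > 0" "S l > 0" "S (Suc l) > 0" using l pos Spos by auto
    have "(\<Sum>j=1..d. u l j * u l j * p j) = (\<Sum>j=1..l. u l j * u l j * p j) + u l (Suc l) * u l (Suc l) * p (Suc l)"
      using l by (intro split) (auto simp: u_def)
    also have "(\<Sum>j=1..l. u l j * u l j * p j) = (\<Sum>j=1..l. p (Suc l) / (S l * S (Suc l)) * p j)"
      using l P by (intro sum.cong) (auto simp: u_def)
    also have "\<dots> = p (Suc l) / (S l * S (Suc l)) * S l"
      by (simp add: S_def sum_distrib_left)
    also have "u l (Suc l) * u l (Suc l) * p (Suc l) = S l / (p (Suc l) * S (Suc l)) * p (Suc l)"
      using l P by (auto simp: u_def)
    also have "p (Suc l) / (S l * S (Suc l)) * S l + S l / (p (Suc l) * S (Suc l)) * p (Suc l) = (p (Suc l) + S l) / S (Suc l)"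
      using P by (simp add: field_simps)
    also have "\<dots> = 1" using P S_Suc[of l] by simp
    finally show ?thesis .
  qed
  have off: "(\<Sum>j=1..d. u l j * u k j * p j) = 0" if "k < l" "l < d" for k l
  proof (cases "k = 0")
    case True
    then show ?thesis
      using zero[of l "u 0" 1] that by (simp add: u_def mult.commute)
  next
    case False
    then show ?thesis
      by (intro zero[where K = "sqrt (p (Suc l) / (S l * S (Suc l)))"])
        (use that in \<open>auto simp: u_def\<close>)
  qed
  have "(\<Sum>j=1..d. u k j * u l j * p j) = (if k = l then 1 else 0)"
    if kl: "k \<in> {0..d-1}" "l \<in> {0..d-1}" for k l
  proof -
    have "d \<noteq> 0" using sum1 by (cases d) auto
    then have lt: "k < d" "l < d" using kl by auto
    consider "k < l" | "l < k" | "k = l" "l = 0" | "k = l" "1 \<le> l" by linarith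
    then show ?thesis
    proof cases
      case 1
      then show ?thesis using off[of k l] lt by (simp add: mult.commute)
    next
      case 2
      then show ?thesis using off[of l k] lt by simp
    next
      case 3
      then show ?thesis using sum1 by (simp add: u_def)
    next
      case 4
      then show ?thesis using one[of l] lt by simp
    qed
  qed
  then have "orthonormal_functions d p u"
    by (auto simp: orthonormal_functions_def u_def)
  then show ?thesis by blast
qed

end

(* The monomials a^x b^y carry a generating function for the kernels: expanding (A + sum_l w_l alpha_l)^N,
   with A = sum_j p_j a_j and alpha_l = sum_j p_j a_j u^(l)_j, and using Parseval for the square
   orthonormal system u,
     sum_{x,y} m(x) m(y) Q_n(x,y) a^x b^y = (N choose n) (A B)^(N-n) (C - A B)^n,
   where B = sum_j p_j b_j and C = sum_j p_j a_j b_j.  The Krawtchouk generating function turns the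
   mixture rho_n = sum_z c_z Q_n(z; N, r) into
     sum_z c_z ((A B - (1-r) C) / r)^z C^(N-z).
   If 1 - r <= min p_j and c >= 0 this has nonnegative coefficients.  Conversely, let p_i be minimal
   and r = 1 - p_i.  Specialising to a = e_i, b_i = E and b_j = D for j ~= i collects the nonnegative
   coefficients into p_i^N sum_z c_z D^z E^(N-z) with c >= 0; then E = 1 + S, D = 1 - ((1-r)/r) S
   gives B = 1, and comparing powers of S identifies rho_n as the mixture with weights c. *)

theory Submission
  imports Defs "Jordan_Normal_Form.Determinant"
begin

section \<open>Multinomial expansion over weak compositions\<close>

lemma sum_single_lookup:
  "(\<Sum>k\<in>Poly_Mapping.keys f. Poly_Mapping.single k (Poly_Mapping.lookup f k)) = f"
  by (rule poly_mapping_eqI) (auto simp: lookup_sum lookup_single when_def in_keys_iff)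

text \<open>Removing the last coordinate is a bijection once \<open>k\<close>, the sum of the first
  \<open>d\<close> coordinates, is recorded: the last entry is then \<open>n - k\<close>. Resetting
  entry \<open>Suc d\<close> to zero undoes the addition of the \<open>single\<close>.\<close>

lemma sum_weak_compositions_Suc:
  fixes f :: "(nat \<Rightarrow>\<^sub>0 nat) \<Rightarrow> 'a::comm_monoid_add"
  shows "(\<Sum>x\<in>weak_compositions (Suc d) n. f x) =
    (\<Sum>k\<le>n. \<Sum>x\<in>weak_compositions d k. f (x + Poly_Mapping.single (Suc d) (n - k)))"
proof -
  have "(\<Sum>x\<in>weak_compositions (Suc d) n. f x) =
    (\<Sum>(k, x)\<in>(SIGMA k:{..n}. weak_compositions d k). f (x + Poly_Mapping.single (Suc d) (n - k)))"
  proof (rule sum.reindex_bij_witness[where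
        i = "\<lambda>(k, x). x + Poly_Mapping.single (Suc d) (n - k)" and
        j = "\<lambda>x. (n - Poly_Mapping.lookup x (Suc d), Poly_Mapping.update (Suc d) 0 x)"], goal_cases)
    case (1 x)
    then show ?case
      by (auto simp: weak_compositions_def lookup_add lookup_single Poly_Mapping.lookup_update when_def
          intro!: poly_mapping_eqI)
  next
    case (2 x)
    then show ?case
      by (auto simp: weak_compositions_def Poly_Mapping.lookup_update in_keys_iff subset_iff le_Suc_eq
          intro!: sum.cong)
  next
    case (3 kx)
    then obtain k x where kx: "kx = (k, x)" "k \<le> n" "x \<in> weak_compositions d k"
      by auto
    have "Suc d \<notin> Poly_Mapping.keys x"
      using kx by (auto simp: weak_compositions_def)
    then have "Poly_Mapping.lookup x (Suc d) = 0"
      by (simp add: in_keys_iff)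
    with kx show ?case
      by (auto simp: lookup_add lookup_single Poly_Mapping.lookup_update when_def intro!: poly_mapping_eqI)
  next
    case (4 kx)
    then obtain k x where kx: "kx = (k, x)" "k \<le> n" "x \<in> weak_compositions d k"
      by auto
    have "Suc d \<notin> Poly_Mapping.keys x"
      using kx by (auto simp: weak_compositions_def)
    then have "Poly_Mapping.lookup x (Suc d) = 0"
      by (simp add: in_keys_iff)
    moreover have "Poly_Mapping.keys (x + Poly_Mapping.single (Suc d) (n - k)) \<subseteq> {1..Suc d}"
    proof (rule order.trans[OF Poly_Mapping.keys_add])
      show "Poly_Mapping.keys x \<union> Poly_Mapping.keys (Poly_Mapping.single (Suc d) (n - k)) \<subseteq> {1..Suc d}"
        using kx by (auto simp: weak_compositions_def split: if_splits)
    qed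
    ultimately show ?case
      using kx by (auto simp: weak_compositions_def lookup_add lookup_single when_def)
  next
    case (5 x)
    then show ?case
      by (auto simp: weak_compositions_def lookup_add lookup_single Poly_Mapping.lookup_update when_def
          intro!: poly_mapping_eqI arg_cong[of _ _ f])
  qed
  also have "\<dots> = (\<Sum>k\<le>n. \<Sum>x\<in>weak_compositions d k. f (x + Poly_Mapping.single (Suc d) (n - k)))"
    by (subst sum.Sigma) (auto simp: finite_weak_compositions)
  finally show ?thesis .
qed

text \<open>Induction on \<open>d\<close>: the binomial theorem separates \<open>c (Suc d)\<close>,
  and its summation index is the total degree \<open>k\<close> of the remaining coordinates. The
  weights are arbitrary reals because later uses put p_j a_j, or products of transforms, in place of
  probabilities.\<close>

lemma multinomial_theorem:
  "(\<Sum>j=1..d. c j) ^ n = (\<Sum>x\<in>weak_compositions d n. multinomial d n c x)"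
proof (induction d arbitrary: n)
  case 0
  have "weak_compositions 0 n = (if n = 0 then {0} else {})"
    by (auto simp: weak_compositions_def)
  then show ?case
    by (simp add: multinomial_def)
next
  case (Suc d)
  have step: "multinomial (Suc d) n c (x + Poly_Mapping.single (Suc d) (n - k)) =
      real (n choose k) * multinomial d k c x * c (Suc d) ^ (n - k)"
    if k: "k \<le> n" and x: "x \<in> weak_compositions d k" for k x
  proof -
    have "Suc d \<notin> Poly_Mapping.keys x"
      using x by (auto simp: weak_compositions_def)
    then have 0: "Poly_Mapping.lookup x (Suc d) = 0"
      by (simp add: in_keys_iff)
    have eq: "Poly_Mapping.lookup (x + Poly_Mapping.single (Suc d) (n - k)) j =
        (if j = Suc d then n - k else Poly_Mapping.lookup x j)" for j
      using 0 by (auto simp: lookup_add lookup_single when_def)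
    have "real (n choose k) = fact n / (fact k * fact (n - k))"
      using k by (rule binomial_fact)
    then show ?thesis
      by (simp add: multinomial_def eq field_simps)
  qed
  have "(\<Sum>j=1..Suc d. c j) ^ n =
      (\<Sum>k\<le>n. real (n choose k) * (\<Sum>j=1..d. c j) ^ k * c (Suc d) ^ (n - k))"
    by (simp add: binomial_ring)
  also have "\<dots> = (\<Sum>k\<le>n. \<Sum>x\<in>weak_compositions d k.
      multinomial (Suc d) n c (x + Poly_Mapping.single (Suc d) (n - k)))"
    unfolding Suc.IH by (intro sum.cong refl) (simp add: step sum_distrib_left sum_distrib_right)
  finally show ?case
    by (simp add: sum_weak_compositions_Suc)
qed

lemma multinomial_mult:
  "multinomial d n (\<lambda>j. a j * b j) x = multinomial d n a x * (\<Prod>j=1..d. b j ^ Poly_Mapping.lookup x j)"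
  by (simp add: multinomial_def power_mult_distrib prod.distrib)

section \<open>Evaluation of finitely supported functions along characters\<close>

definition eval_pm :: "('m \<Rightarrow> real) \<Rightarrow> ('m \<Rightarrow>\<^sub>0 real) \<Rightarrow> real" where
  "eval_pm \<psi> f = (\<Sum>k\<in>Poly_Mapping.keys f. Poly_Mapping.lookup f k * \<psi> k)"

lemma eval_pm_superset:
  assumes "finite K" "Poly_Mapping.keys f \<subseteq> K"
  shows "eval_pm \<psi> f = (\<Sum>k\<in>K. Poly_Mapping.lookup f k * \<psi> k)"
  unfolding eval_pm_def using assms by (intro sum.mono_neutral_left) (auto simp: in_keys_iff)

lemma eval_pm_zero [simp]: "eval_pm \<psi> 0 = 0"
  by (simp add: eval_pm_def)

lemma eval_pm_single [simp]: "eval_pm \<psi> (Poly_Mapping.single k c) = c * \<psi> k"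
  by (simp add: eval_pm_def)

lemma eval_pm_add: "eval_pm \<psi> (f + g) = eval_pm \<psi> f + eval_pm \<psi> g"
proof -
  let ?K = "Poly_Mapping.keys f \<union> Poly_Mapping.keys g"
  have "eval_pm \<psi> h = (\<Sum>k\<in>?K. Poly_Mapping.lookup h k * \<psi> k)" if "h \<in> {f, g, f + g}" for h
    using that Poly_Mapping.keys_add[of f g] by (intro eval_pm_superset) auto
  then show ?thesis
    by (simp add: lookup_add distrib_right sum.distrib)
qed

lemma eval_pm_diff: "eval_pm \<psi> (f - g) = eval_pm \<psi> f - eval_pm \<psi> g"
  using eval_pm_add[of \<psi> "f - g" g] by simp

lemma eval_pm_sum: "eval_pm \<psi> (\<Sum>i\<in>I. f i) = (\<Sum>i\<in>I. eval_pm \<psi> (f i))"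
  by (induction I rule: infinite_finite_induct) (simp_all add: eval_pm_add)

text \<open>A map turning addition of exponents into multiplication makes \<open>eval_pm\<close> a
  ring homomorphism. The abstraction covers polynomials in one family of variables and in two
  families at once.\<close>

locale monoid_character =
  fixes \<psi> :: "'m::comm_monoid_add \<Rightarrow> real"
  assumes char_zero [simp]: "\<psi> 0 = 1"
    and char_add: "\<psi> (a + b) = \<psi> a * \<psi> b"
begin

lemma eval_pm_one [simp]: "eval_pm \<psi> 1 = 1"
  using eval_pm_single[of \<psi> 0 1] by simp

lemma eval_pm_mult: "eval_pm \<psi> (f * g) = eval_pm \<psi> f * eval_pm \<psi> g"
proof -
  have "eval_pm \<psi> (f * g) = eval_pm \<psi>
     ((\<Sum>k\<in>Poly_Mapping.keys f. Poly_Mapping.single k (Poly_Mapping.lookup f k)) *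
      (\<Sum>k\<in>Poly_Mapping.keys g. Poly_Mapping.single k (Poly_Mapping.lookup g k)))"
    by (simp add: sum_single_lookup)
  also have "\<dots> = (\<Sum>i\<in>Poly_Mapping.keys f. \<Sum>j\<in>Poly_Mapping.keys g.
      (Poly_Mapping.lookup f i * \<psi> i) * (Poly_Mapping.lookup g j * \<psi> j))"
    by (simp add: sum_product eval_pm_sum mult_single char_add mult_ac)
  also have "\<dots> = eval_pm \<psi> f * eval_pm \<psi> g"
    by (simp add: eval_pm_def sum_product)
  finally show ?thesis .
qed

lemma eval_pm_power: "eval_pm \<psi> (f ^ n) = eval_pm \<psi> f ^ n"
  by (induction n) (simp_all add: eval_pm_mult)

lemma eval_pm_prod: "eval_pm \<psi> (\<Prod>i\<in>I. f i) = (\<Prod>i\<in>I. eval_pm \<psi> (f i))"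
  by (induction I rule: infinite_finite_induct) (simp_all add: eval_pm_mult)

end

section \<open>Monomials as characters; polynomials determined by their values\<close>

definition monom_val :: "(nat \<Rightarrow> real) \<Rightarrow> (nat \<Rightarrow>\<^sub>0 nat) \<Rightarrow> real" where
  "monom_val v k = (\<Prod>l\<in>Poly_Mapping.keys k. v l ^ Poly_Mapping.lookup k l)"

lemma monom_val_superset:
  assumes "finite L" "Poly_Mapping.keys k \<subseteq> L"
  shows "monom_val v k = (\<Prod>l\<in>L. v l ^ Poly_Mapping.lookup k l)"
  unfolding monom_val_def using assms by (intro prod.mono_neutral_left) (auto simp: in_keys_iff)

lemma monom_val_weak_composition:
  "k \<in> weak_compositions d n \<Longrightarrow> monom_val v k = (\<Prod>j=1..d. v j ^ Poly_Mapping.lookup k j)"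
  by (rule monom_val_superset) (auto simp: weak_compositions_def)

lemma monom_val_single [simp]: "monom_val v (Poly_Mapping.single l n) = v l ^ n"
  by (simp add: monom_val_def)

lemma monom_val_zero [simp]: "monom_val v 0 = 1"
  by (simp add: monom_val_def)

lemma monom_val_add: "monom_val v (j + k) = monom_val v j * monom_val v k"
proof -
  let ?L = "Poly_Mapping.keys j \<union> Poly_Mapping.keys k"
  have "monom_val v h = (\<Prod>l\<in>?L. v l ^ Poly_Mapping.lookup h l)" if "h \<in> {j, k, j + k}" for h
    using that Poly_Mapping.keys_add[of j k] by (intro monom_val_superset) auto
  then show ?thesis
    by (simp add: lookup_add power_add prod.distrib)
qed

interpretation monom: monoid_character "monom_val v" for v
  by standard (simp_all add: monom_val_add)

text \<open>A pair of exponents stands for the monomial a^x b^y in two independent families of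
  variables, the setting of the kernels.\<close>

interpretation monom_pair: monoid_character "\<lambda>(x, y). monom_val a x * monom_val b y" for a b
  by standard (auto simp: monom_val_add zero_prod_def)

text \<open>Induction on the set of variables. With the others fixed, the sum is a polynomial in the
  value \<open>t\<close> at \<open>l\<close> that vanishes everywhere, so each of its coefficients
  does. The separation hypothesis survives because the exponents in one class \<open>K' i\<close>
  agree at \<open>l\<close>, so the remaining variables tell them apart.\<close>

lemma monomials_independent:
  fixes c :: "(nat \<Rightarrow>\<^sub>0 nat) \<Rightarrow> real"
  assumes "finite L" "finite K"
    and "\<And>k k'. k \<in> K \<Longrightarrow> k' \<in> K \<Longrightarrow>
      (\<forall>l\<in>L. Poly_Mapping.lookup k l = Poly_Mapping.lookup k' l) \<Longrightarrow> k = k'"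
    and "\<And>v. (\<Sum>k\<in>K. c k * (\<Prod>l\<in>L. v l ^ Poly_Mapping.lookup k l)) = 0"
    and "k \<in> K"
  shows "c k = 0"
  using assms
proof (induction L arbitrary: K k rule: finite_induct)
  case empty
  \<comment> \<open>Without variables the separation hypothesis identifies all exponents.\<close>
  then have "K = {k}" by auto
  with empty.prems show ?case by simp
next
  case (insert l L)
  let ?e = "\<lambda>k. Poly_Mapping.lookup k l"
  define n where "n = Max (?e ` K)"
  define K' where "K' i = {k\<in>K. ?e k = i}" for i
  have n: "?e ` K \<subseteq> {..n}"
    using insert.prems(1) by (auto simp: n_def)
  have vanish: "(\<Sum>k\<in>K' i. c k * (\<Prod>l\<in>L. v l ^ Poly_Mapping.lookup k l)) = 0" (is "?S i = 0")
    if "i \<le> n" for i v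
  proof -
    \<comment> \<open>At the point \<open>v(l := t)\<close> the sum over \<open>K\<close> regroups
      by the exponent of \<open>l\<close> into a polynomial in \<open>t\<close> with coefficients
      \<open>?S i\<close>.\<close>
    have "(\<Sum>i\<le>n. ?S i * t ^ i) = 0" for t
    proof -
      have "(\<Sum>i\<le>n. ?S i * t ^ i) = (\<Sum>i\<le>n. \<Sum>k\<in>K' i.
          c k * (\<Prod>l'\<in>insert l L. (v(l := t)) l' ^ Poly_Mapping.lookup k l'))"
      proof (intro sum.cong refl, unfold sum_distrib_right, intro sum.cong refl)
        fix i k assume "k \<in> K' i"
        moreover have "(\<Prod>l'\<in>L. (v(l := t)) l' ^ Poly_Mapping.lookup k l') =
            (\<Prod>l'\<in>L. v l' ^ Poly_Mapping.lookup k l')"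
          using insert.hyps by (intro prod.cong) auto
        ultimately show "c k * (\<Prod>l\<in>L. v l ^ Poly_Mapping.lookup k l) * t ^ i =
            c k * (\<Prod>l'\<in>insert l L. (v(l := t)) l' ^ Poly_Mapping.lookup k l')"
          using insert.hyps by (simp add: K'_def)
      qed
      also have "\<dots> = (\<Sum>k\<in>K. c k * (\<Prod>l'\<in>insert l L. (v(l := t)) l' ^ Poly_Mapping.lookup k l'))"
        unfolding K'_def using insert.prems(1) n by (intro sum.group) auto
      finally show ?thesis
        by (simp only: insert.prems(3))
    qed
    then show ?thesis
      using polyfun_eq_0[of ?S n] that by blast
  qed
  have "?e k \<le> n"
    using n insert.prems(4) by auto
  then show ?case
    using insert.prems
    by (intro insert.IH[of "K' (?e k)"] vanish) (auto simp: K'_def)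
qed

lemma eval_pm_eq_0_imp:
  assumes "\<And>v. eval_pm (monom_val v) f = 0"
  shows "f = 0"
proof (rule poly_mapping_eqI)
  fix k
  \<comment> \<open>These are the variables occurring in \<open>f\<close>. All its exponents vanish
    elsewhere, so agreement on \<open>?L\<close> is equality.\<close>
  let ?L = "\<Union>k\<in>Poly_Mapping.keys f. Poly_Mapping.keys k"
  have fin: "finite ?L" by simp
  have "Poly_Mapping.lookup f k = 0" if "k \<in> Poly_Mapping.keys f"
  proof (rule monomials_independent[OF fin _ _ _ that])
    fix v
    have "(\<Sum>k\<in>Poly_Mapping.keys f. Poly_Mapping.lookup f k * (\<Prod>l\<in>?L. v l ^ Poly_Mapping.lookup k l)) =
        eval_pm (monom_val v) f"
      unfolding eval_pm_def
      by (intro sum.cong refl arg_cong2[of _ _ _ _ times] monom_val_superset[symmetric] fin) auto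
    then show "(\<Sum>k\<in>Poly_Mapping.keys f. Poly_Mapping.lookup f k * (\<Prod>l\<in>?L. v l ^ Poly_Mapping.lookup k l)) = 0"
      using assms by simp
  next
    fix j k assume jk: "j \<in> Poly_Mapping.keys f" "k \<in> Poly_Mapping.keys f"
      and eq: "\<forall>l\<in>?L. Poly_Mapping.lookup j l = Poly_Mapping.lookup k l"
    show "j = k"
    proof (rule poly_mapping_eqI)
      fix l
      show "Poly_Mapping.lookup j l = Poly_Mapping.lookup k l"
        using eq jk by (cases "l \<in> ?L") (auto simp: in_keys_iff)
    qed
  qed simp
  then show "Poly_Mapping.lookup f k = Poly_Mapping.lookup 0 k"
    by (auto simp: in_keys_iff)
qed

lemma eval_pm_eqI:
  assumes "\<And>v. eval_pm (monom_val v) f = eval_pm (monom_val v) g"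
  shows "f = g"
  using eval_pm_eq_0_imp[of "f - g"] assms by (simp add: eval_pm_diff)

text \<open>The result for one family is applied twice: for fixed \<open>b\<close> the coefficients
  \<open>col b x\<close> of a^x vanish, and as \<open>b\<close> varies these are polynomials with
  coefficients h(x, y), which therefore vanish too.\<close>

lemma eval_pm_pair_eqI:
  fixes f g :: "((nat \<Rightarrow>\<^sub>0 nat) \<times> (nat \<Rightarrow>\<^sub>0 nat)) \<Rightarrow>\<^sub>0 real"
  assumes "\<And>a b. eval_pm (\<lambda>(x, y). monom_val a x * monom_val b y) f =
    eval_pm (\<lambda>(x, y). monom_val a x * monom_val b y) g"
  shows "f = g"
proof -
  define h where "h = f - g"
  define X where "X = fst ` Poly_Mapping.keys h"
  define Y where "Y = snd ` Poly_Mapping.keys h"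
  have fin: "finite X" "finite Y" and sub: "Poly_Mapping.keys h \<subseteq> X \<times> Y"
    by (simp_all add: X_def Y_def subset_fst_snd)
  define col where "col b x = (\<Sum>y\<in>Y. Poly_Mapping.lookup h (x, y) * monom_val b y)" for b x
  have col_sum: "(\<Sum>x\<in>X. Poly_Mapping.single x (col b x)) = 0" for b
  proof (rule eval_pm_eq_0_imp)
    fix a
    have "eval_pm (monom_val a) (\<Sum>x\<in>X. Poly_Mapping.single x (col b x)) =
        (\<Sum>(x, y)\<in>X \<times> Y. Poly_Mapping.lookup h (x, y) * (monom_val a x * monom_val b y))"
      unfolding eval_pm_sum eval_pm_single col_def sum_distrib_right sum.cartesian_product
      by (intro sum.cong) (auto simp: mult_ac)
    also have "\<dots> = eval_pm (\<lambda>(x, y). monom_val a x * monom_val b y) h"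
      by (subst eval_pm_superset[OF _ sub]) (simp_all add: fin case_prod_unfold)
    also have "\<dots> = 0"
      using assms by (simp add: h_def eval_pm_diff)
    finally show "eval_pm (monom_val a) (\<Sum>x\<in>X. Poly_Mapping.single x (col b x)) = 0" .
  qed
  have col: "col b x = 0" if "x \<in> X" for b x
  proof -
    have "col b x = Poly_Mapping.lookup (\<Sum>x\<in>X. Poly_Mapping.single x (col b x)) x"
      using that fin by (simp add: lookup_sum lookup_single when_def)
    then show ?thesis
      by (simp add: col_sum)
  qed
  have row_sum: "(\<Sum>y\<in>Y. Poly_Mapping.single y (Poly_Mapping.lookup h (x, y))) = 0" if "x \<in> X" for x
    by (rule eval_pm_eq_0_imp) (use col[OF that] in \<open>simp add: eval_pm_sum col_def\<close>)
  have "Poly_Mapping.lookup h (x, y) = 0" if "x \<in> X" "y \<in> Y" for x y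
  proof -
    have "Poly_Mapping.lookup h (x, y) =
        Poly_Mapping.lookup (\<Sum>y\<in>Y. Poly_Mapping.single y (Poly_Mapping.lookup h (x, y))) y"
      using that fin by (simp add: lookup_sum lookup_single when_def)
    then show ?thesis
      by (simp add: row_sum[OF that(1)])
  qed
  then have lookup_zero: "Poly_Mapping.lookup h k = 0" if "k \<in> X \<times> Y" for k
    using that by blast
  have "h = 0"
  proof (rule poly_mapping_eqI)
    fix k
    show "Poly_Mapping.lookup h k = Poly_Mapping.lookup 0 k"
    proof (cases "k \<in> Poly_Mapping.keys h")
      case True
      then show ?thesis
        using lookup_zero sub by auto
    qed (simp add: in_keys_iff)
  qed
  then show ?thesis
    by (simp add: h_def)
qed

section \<open>Products of polynomials with nonnegative coefficients\<close>

lemma lookup_mult_nonneg: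
  fixes f g :: "'m::monoid_add \<Rightarrow>\<^sub>0 real"
  assumes "\<And>k. Poly_Mapping.lookup f k \<ge> 0" "\<And>k. Poly_Mapping.lookup g k \<ge> 0"
  shows "Poly_Mapping.lookup (f * g) k \<ge> 0"
proof -
  have "f * g = (\<Sum>i\<in>Poly_Mapping.keys f. Poly_Mapping.single i (Poly_Mapping.lookup f i)) *
      (\<Sum>j\<in>Poly_Mapping.keys g. Poly_Mapping.single j (Poly_Mapping.lookup g j))"
    by (simp add: sum_single_lookup)
  then show ?thesis
    using assms
    by (simp add: sum_product mult_single lookup_sum lookup_single when_def sum_nonneg)
qed

lemma lookup_power_nonneg:
  fixes f :: "'m::monoid_add \<Rightarrow>\<^sub>0 real"
  assumes "\<And>k. Poly_Mapping.lookup f k \<ge> 0"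
  shows "Poly_Mapping.lookup (f ^ n) k \<ge> 0"
proof (induction n arbitrary: k)
  case 0
  then show ?case
    by (simp add: lookup_one when_def)
next
  case (Suc n)
  then show ?case
    using assms by (simp add: lookup_mult_nonneg)
qed

section \<open>Transforms and norms of the multivariate Krawtchouk polynomials\<close>

lemma multinomial_cong:
  "(\<And>j. j \<in> {1..d} \<Longrightarrow> p j = q j) \<Longrightarrow> multinomial d n p x = multinomial d n q x"
  by (simp add: multinomial_def)

lemma multinomial_gen_fun:
  "(\<Sum>x\<in>weak_compositions d n. multinomial d n p x * (\<Prod>j=1..d. a j ^ Poly_Mapping.lookup x j)) =
    (\<Sum>j=1..d. p j * a j) ^ n"
  unfolding multinomial_theorem multinomial_mult ..

text \<open>Constant polynomials appear as \<open>single 0 c\<close>, zero being the exponent of the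
  empty monomial. This reads off coefficients of weighted sums of generating functions.\<close>

lemma lookup_single_zero_mult:
  "Poly_Mapping.lookup (Poly_Mapping.single 0 c * f) k = c * Poly_Mapping.lookup f k"
  for f :: "'m::comm_monoid_add \<Rightarrow>\<^sub>0 real"
  by (simp add: mult_map_scale_conv_mult[symmetric] Poly_Mapping.map.rep_eq when_def)

lemma eval_mv_gen_fun:
  "eval_pm (monom_val v) (mv_gen_fun d u x) =
    (\<Prod>j=1..d. (1 + (\<Sum>l=1..d-1. v l * u l j)) ^ Poly_Mapping.lookup x j)"
  by (simp add: mv_gen_fun_def monom.eval_pm_prod monom.eval_pm_power eval_pm_add eval_pm_sum mult.commute)

text \<open>Summing the whole generating function in w over x collapses, by the multinomial theorem,
  to (A + sum_l w_l \<alpha>_l)^N. The claim compares the coefficients of w^n on both sides.\<close>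

lemma mv_krawtchouk_transform:
  assumes "k \<le> N" and n: "n \<in> weak_compositions (d - 1) k"
  shows "(\<Sum>x\<in>weak_compositions d N. multinomial d N p x *
        (\<Prod>j=1..d. a j ^ Poly_Mapping.lookup x j) * mv_krawtchouk d u n x) =
      real (N choose k) * (\<Sum>j=1..d. p j * a j) ^ (N - k) *
        multinomial (d - 1) k (\<lambda>l. \<Sum>j=1..d. p j * a j * u l j) n"
proof -
  define A where "A = (\<Sum>j=1..d. p j * a j)"
  define \<alpha> where "\<alpha> = (\<lambda>l. \<Sum>j=1..d. p j * a j * u l j)"
  define m where "m x = multinomial d N p x * (\<Prod>j=1..d. a j ^ Poly_Mapping.lookup x j)" for x
  define g where "g k n = real (N choose k) * A ^ (N - k) * multinomial (d - 1) k \<alpha> n" for k n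
  define T where "T = (\<Sum>x\<in>weak_compositions d N. Poly_Mapping.single 0 (m x) * mv_gen_fun d u x)"
  define G where "G = (\<Sum>k\<le>N. \<Sum>n\<in>weak_compositions (d - 1) k. Poly_Mapping.single n (g k n))"
  have "T = G"
  proof (rule eval_pm_eqI)
    fix v
    \<comment> \<open>At w = v the generating function is itself a product of powers with exponents
      x_j, so it merges with a^x into one monomial in \<open>?b\<close>.\<close>
    let ?b = "\<lambda>j. a j * (1 + (\<Sum>l=1..d-1. v l * u l j))"
    have "eval_pm (monom_val v) T =
        (\<Sum>x\<in>weak_compositions d N. multinomial d N p x * (\<Prod>j=1..d. ?b j ^ Poly_Mapping.lookup x j))"
      by (simp add: T_def m_def eval_pm_sum monom.eval_pm_mult eval_mv_gen_fun power_mult_distrib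
          prod.distrib mult.assoc)
    also have "\<dots> = (\<Sum>j=1..d. p j * ?b j) ^ N"
      by (rule multinomial_gen_fun)
    also have "(\<Sum>j=1..d. p j * ?b j) = A + (\<Sum>j=1..d. \<Sum>l=1..d-1. p j * a j * u l j * v l)"
      by (simp add: A_def distrib_left sum.distrib sum_distrib_left mult_ac)
    also have "(\<Sum>j=1..d. \<Sum>l=1..d-1. p j * a j * u l j * v l) = (\<Sum>l=1..d-1. \<alpha> l * v l)"
      by (subst sum.swap) (simp add: \<alpha>_def sum_distrib_right)
    also have "(A + \<dots>) ^ N = (\<Sum>k\<le>N. real (N choose k) * (\<Sum>l=1..d-1. \<alpha> l * v l) ^ k * A ^ (N - k))"
      by (subst add.commute) (simp add: binomial_ring)
    also have "\<dots> = (\<Sum>k\<le>N. \<Sum>n\<in>weak_compositions (d - 1) k. g k n * monom_val v n)"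
      unfolding multinomial_gen_fun[symmetric]
      by (intro sum.cong refl)
        (simp add: g_def sum_distrib_left sum_distrib_right monom_val_weak_composition mult_ac)
    also have "\<dots> = eval_pm (monom_val v) G"
      by (simp add: G_def eval_pm_sum)
    finally show "eval_pm (monom_val v) T = eval_pm (monom_val v) G" .
  qed
  have "Poly_Mapping.lookup T n = (\<Sum>x\<in>weak_compositions d N. m x * mv_krawtchouk d u n x)"
    by (simp add: T_def lookup_sum lookup_single_zero_mult mv_krawtchouk_def)
  moreover have "Poly_Mapping.lookup G n = g k n"
  proof -
    have "Poly_Mapping.lookup G n = (\<Sum>i\<le>N. if n \<in> weak_compositions (d - 1) i then g i n else 0)"
      by (simp add: G_def lookup_sum lookup_single when_def finite_weak_compositions)
    \<comment> \<open>The entries of \<open>n\<close> sum to \<open>k\<close>, so only the block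
      \<open>i = k\<close> contains it.\<close>
    also have "\<dots> = (\<Sum>i\<le>N. if i = k then g i n else 0)"
      using n by (intro sum.cong) (auto simp: weak_compositions_def)
    finally show ?thesis
      using \<open>k \<le> N\<close> by simp
  qed
  ultimately have "(\<Sum>x\<in>weak_compositions d N. m x * mv_krawtchouk d u n x) = g k n"
    using \<open>T = G\<close> by metis
  then show ?thesis
    unfolding m_def g_def A_def \<alpha>_def .
qed

text \<open>If a_j is the factor 1 + sum_l v_l u^(l)_j, then a^x is the generating function at v,
  while orthonormality turns the transform into A = 1 and \<alpha>_l = v_l. So the polynomial
  \<open>T\<close>, whose coefficients are the inner products with Q_n, is a single monomial in v^n,
  and its coefficient is the squared norm N! / (n_1! ... n_(d-1)! (N-k)!).\<close>

lemma mv_krawtchouk_norm: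
  assumes u: "orthonormal_functions d p u" and k: "k \<le> N" and n: "n \<in> weak_compositions (d - 1) k"
  shows "(\<Sum>x\<in>weak_compositions d N. multinomial d N p x * (mv_krawtchouk d u n x)\<^sup>2) =
    real (N choose k) * multinomial (d - 1) k (\<lambda>_. 1) n"
proof -
  have inner: "(\<Sum>j=1..d. p j * u k j * u l j) = (if k = l then 1 else 0)"
    if "k \<le> d - 1" "l \<le> d - 1" for k l
    using u that by (simp add: orthonormal_functions_def mult_ac)
  have u0: "u 0 j = 1" if "j \<in> {1..d}" for j
    using u that by (simp add: orthonormal_functions_def)
  define T where "T = (\<Sum>x\<in>weak_compositions d N.
    Poly_Mapping.single 0 (multinomial d N p x * mv_krawtchouk d u n x) * mv_gen_fun d u x)"
  define M where "M = real (N choose k) * multinomial (d - 1) k (\<lambda>_. 1) n"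
  have "T = Poly_Mapping.single n M"
  proof (rule eval_pm_eqI)
    fix v
    define a where "a j = 1 + (\<Sum>l=1..d-1. v l * u l j)" for j
    \<comment> \<open>Pairing with \<open>u k\<close> selects the coefficient of \<open>u k\<close>
      in \<open>a\<close>; the coefficient of \<open>u 0\<close> is the constant 1.\<close>
    have proj: "(\<Sum>j=1..d. p j * a j * u k j) = (if k = 0 then 1 else v k)" if "k \<le> d - 1" for k
    proof -
      have "(\<Sum>j=1..d. p j * a j * u k j) =
          (\<Sum>j=1..d. p j * u 0 j * u k j) + (\<Sum>j=1..d. \<Sum>l=1..d-1. v l * (p j * u l j * u k j))"
        by (simp add: a_def u0 distrib_left distrib_right sum.distrib sum_distrib_left
            sum_distrib_right mult_ac)
      also have "(\<Sum>j=1..d. \<Sum>l=1..d-1. v l * (p j * u l j * u k j)) =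
          (\<Sum>l=1..d-1. v l * (\<Sum>j=1..d. p j * u l j * u k j))"
        by (subst sum.swap) (simp add: sum_distrib_left)
      also have "\<dots> = (\<Sum>l=1..d-1. if l = k then v l else 0)"
        using that by (intro sum.cong) (auto simp: inner simp del: One_nat_def)
      finally show ?thesis
        using that inner[of 0 k] by (auto simp del: One_nat_def)
    qed
    have "(\<Sum>j=1..d. p j * a j) = (\<Sum>j=1..d. p j * a j * u 0 j)"
      by (simp add: u0)
    then have A: "(\<Sum>j=1..d. p j * a j) = 1"
      using proj[of 0] by simp
    have "eval_pm (monom_val v) T = (\<Sum>x\<in>weak_compositions d N. multinomial d N p x *
        (\<Prod>j=1..d. a j ^ Poly_Mapping.lookup x j) * mv_krawtchouk d u n x)"
      by (simp add: T_def eval_pm_sum monom.eval_pm_mult eval_mv_gen_fun a_def mult_ac)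
    also have "\<dots> = real (N choose k) * multinomial (d - 1) k (\<lambda>l. \<Sum>j=1..d. p j * a j * u l j) n"
      unfolding mv_krawtchouk_transform[OF k n] A by simp
    also have "multinomial (d - 1) k (\<lambda>l. \<Sum>j=1..d. p j * a j * u l j) n = multinomial (d - 1) k (\<lambda>l. 1 * v l) n"
      by (rule multinomial_cong) (use proj in auto)
    also have "\<dots> = multinomial (d - 1) k (\<lambda>_. 1) n * monom_val v n"
      unfolding multinomial_mult monom_val_weak_composition[OF n] ..
    finally show "eval_pm (monom_val v) T = eval_pm (monom_val v) (Poly_Mapping.single n M)"
      by (simp add: M_def)
  qed
  moreover have "Poly_Mapping.lookup T n =
      (\<Sum>x\<in>weak_compositions d N. multinomial d N p x * (mv_krawtchouk d u n x)\<^sup>2)"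
    by (simp add: T_def lookup_sum lookup_single_zero_mult mv_krawtchouk_def power2_eq_square mult.assoc)
  ultimately show ?thesis
    by (simp add: M_def)
qed

section \<open>Completeness, Parseval and the generating function of one kernel\<close>

lemma orthonormal_functions_complete:
  assumes u: "orthonormal_functions d p u" and "i \<in> {1..d}" "j \<in> {1..d}"
  shows "(\<Sum>l<d. u l i * u l j * p j) = (if i = j then 1 else 0)"
proof -
  \<comment> \<open>The weights sit in one factor only, so that orthonormality reads U V = 1. Matrix
    indices start at 0, hence the shift to coordinate \<open>Suc j\<close>.\<close>
  define U where "U = mat d d (\<lambda>(l, j). u l (Suc j) * p (Suc j))"
  define V where "V = mat d d (\<lambda>(j, l). u l (Suc j))"
  have "U * V = 1\<^sub>m d"
  proof (rule eq_matI)
    fix k l assume "k < dim_row (1\<^sub>m d :: real mat)" "l < dim_col (1\<^sub>m d :: real mat)"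
    then have kl: "k < d" "l < d" by auto
    then have "(U * V) $$ (k, l) = (\<Sum>j<d. u k (Suc j) * u l (Suc j) * p (Suc j))"
      by (simp add: U_def V_def scalar_prod_def atLeast0LessThan mult_ac)
    also have "\<dots> = (\<Sum>j=1..d. u k j * u l j * p j)"
      by (simp add: sum.atLeast1_atMost_eq)
    also have "\<dots> = (if k = l then 1 else 0)"
      using u kl unfolding orthonormal_functions_def by auto
    finally show "(U * V) $$ (k, l) = 1\<^sub>m d $$ (k, l)"
      using kl by simp
  qed (auto simp: U_def V_def)
  \<comment> \<open>Both matrices are square because there are exactly \<open>d\<close> functions
    including \<open>u 0\<close>; a one-sided inverse is then two-sided, and V U = 1 is
    completeness.\<close>
  then have "V * U = 1\<^sub>m d"
    by (rule mat_mult_left_right_inverse[rotated 2]) (auto simp: U_def V_def)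
  moreover have "(V * U) $$ (i - 1, j - 1) = (\<Sum>l<d. u l i * u l j * p j)"
    using assms(2,3) less_le_trans[of "i - 1" i d]
    by (auto simp: U_def V_def scalar_prod_def atLeast0LessThan mult_ac)
  ultimately show ?thesis
    using assms(2,3) by (cases i; cases j) auto
qed

text \<open>By completeness, the sum over all l < d, including l = 0, is sum_j p_j a_j b_j. The
  subtracted product is the term of the constant function \<open>u 0\<close>.\<close>

lemma orthonormal_functions_parseval:
  assumes u: "orthonormal_functions d p u" and d: "d \<ge> 1"
  shows "(\<Sum>l=1..d-1. (\<Sum>j=1..d. p j * a j * u l j) * (\<Sum>j=1..d. p j * b j * u l j)) =
    (\<Sum>j=1..d. p j * a j * b j) - (\<Sum>j=1..d. p j * a j) * (\<Sum>j=1..d. p j * b j)"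
proof -
  have u0: "u 0 j = 1" if "j \<in> {1..d}" for j
    using u that by (simp add: orthonormal_functions_def)
  let ?f = "\<lambda>l. (\<Sum>j=1..d. p j * a j * u l j) * (\<Sum>j=1..d. p j * b j * u l j)"
  have "(\<Sum>l<d. ?f l) = (\<Sum>l<d. \<Sum>i=1..d. \<Sum>j=1..d. (p i * a i * u l i) * (p j * b j * u l j))"
    by (simp add: sum_product)
  also have "\<dots> = (\<Sum>i=1..d. \<Sum>l<d. \<Sum>j=1..d. (p i * a i * u l i) * (p j * b j * u l j))"
    by (rule sum.swap)
  also have "\<dots> = (\<Sum>i=1..d. \<Sum>j=1..d. \<Sum>l<d. (p i * a i * u l i) * (p j * b j * u l j))"
    by (intro sum.cong refl sum.swap)
  also have "\<dots> = (\<Sum>i=1..d. \<Sum>j=1..d. p i * a i * b j * (\<Sum>l<d. u l i * u l j * p j))"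
    by (simp add: sum_distrib_left mult_ac)
  also have "\<dots> = (\<Sum>i=1..d. \<Sum>j=1..d. if i = j then p i * a i * b j else 0)"
    using orthonormal_functions_complete[OF u] by (intro sum.cong refl) simp
  also have "\<dots> = (\<Sum>j=1..d. p j * a j * b j)"
    by simp
  finally have "(\<Sum>j=1..d. p j * a j * b j) = ?f 0 + (\<Sum>l=1..d-1. ?f l)"
    using d by (cases d) (simp_all add: sum.lessThan_Suc_shift sum.atLeast1_atMost_eq del: sum.lessThan_Suc)
  then show ?thesis
    by (simp add: u0)
qed

text \<open>Each summand of the kernel separates x from y, so its double sum is a product of two
  transforms over a squared norm. What remains after cancellation is a multinomial term in the
  products \<alpha>_l(a) \<alpha>_l(b); the multinomial theorem sums these over \<open>k\<close>,
  and Parseval evaluates the base.\<close>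

lemma kernel_poly_gen_fun:
  assumes u: "orthonormal_functions d p u" and d: "d \<ge> 1" and n: "n \<le> N"
  defines "A \<equiv> \<lambda>a. \<Sum>j=1..d. p j * a j"
  shows "(\<Sum>x\<in>weak_compositions d N. \<Sum>y\<in>weak_compositions d N.
      multinomial d N p x * multinomial d N p y * kernel_poly d N p u n x y *
      (\<Prod>j=1..d. a j ^ Poly_Mapping.lookup x j) * (\<Prod>j=1..d. b j ^ Poly_Mapping.lookup y j)) =
    real (N choose n) * (A a * A b) ^ (N - n) * ((\<Sum>j=1..d. p j * a j * b j) - A a * A b) ^ n"
proof -
  let ?W = "weak_compositions d N" and ?K = "weak_compositions (d - 1) n"
  let ?\<alpha> = "\<lambda>a l. \<Sum>j=1..d. p j * a j * u l j"
  define M where "M k = multinomial (d - 1) n (\<lambda>_. 1) k" for k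
  define T where "T a k = (\<Sum>x\<in>?W. multinomial d N p x *
    (\<Prod>j=1..d. a j ^ Poly_Mapping.lookup x j) * mv_krawtchouk d u k x)" for a k
  define pr where "pr c k = (\<Prod>l=1..d-1. c l ^ Poly_Mapping.lookup k l)" for c :: "nat \<Rightarrow> real" and k
  have Mpos: "M k > 0" for k
    by (simp add: M_def multinomial_def prod_pos)
  have Npos: "real (N choose n) > 0"
    using n by simp
  have mult: "multinomial (d - 1) n c k = M k * pr c k" for c k
    using multinomial_mult[of "d - 1" n "\<lambda>_. 1" c k] by (simp add: M_def pr_def)
  have T: "T a k = real (N choose n) * A a ^ (N - n) * (M k * pr (?\<alpha> a) k)" if "k \<in> ?K" for a k
    unfolding T_def mv_krawtchouk_transform[OF n that] mult A_def ..
  \<comment> \<open>The square roots in the two unit-norm scalings multiply to the squared norm,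
    which is positive.\<close>
  have unit: "mv_krawtchouk_unit d N p u k x * mv_krawtchouk_unit d N p u k y =
      mv_krawtchouk d u k x * mv_krawtchouk d u k y / (real (N choose n) * M k)" if "k \<in> ?K" for k x y
    using Npos Mpos[of k]
    unfolding mv_krawtchouk_unit_def mv_krawtchouk_norm[OF u n that] M_def[symmetric] by simp
  have "(\<Sum>x\<in>?W. \<Sum>y\<in>?W. multinomial d N p x * multinomial d N p y * kernel_poly d N p u n x y *
      (\<Prod>j=1..d. a j ^ Poly_Mapping.lookup x j) * (\<Prod>j=1..d. b j ^ Poly_Mapping.lookup y j)) =
    (\<Sum>x\<in>?W. \<Sum>y\<in>?W. \<Sum>k\<in>?K.
      (multinomial d N p x * (\<Prod>j=1..d. a j ^ Poly_Mapping.lookup x j) * mv_krawtchouk d u k x) *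
      (multinomial d N p y * (\<Prod>j=1..d. b j ^ Poly_Mapping.lookup y j) * mv_krawtchouk d u k y) /
      (real (N choose n) * M k))"
    unfolding kernel_poly_def sum_distrib_left sum_distrib_right
    by (intro sum.cong refl) (simp add: unit)
  also have "\<dots> = (\<Sum>x\<in>?W. \<Sum>k\<in>?K. \<Sum>y\<in>?W.
      (multinomial d N p x * (\<Prod>j=1..d. a j ^ Poly_Mapping.lookup x j) * mv_krawtchouk d u k x) *
      (multinomial d N p y * (\<Prod>j=1..d. b j ^ Poly_Mapping.lookup y j) * mv_krawtchouk d u k y) /
      (real (N choose n) * M k))"
    by (intro sum.cong refl sum.swap)
  also have "\<dots> = (\<Sum>k\<in>?K. \<Sum>x\<in>?W. \<Sum>y\<in>?W.
      (multinomial d N p x * (\<Prod>j=1..d. a j ^ Poly_Mapping.lookup x j) * mv_krawtchouk d u k x) *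
      (multinomial d N p y * (\<Prod>j=1..d. b j ^ Poly_Mapping.lookup y j) * mv_krawtchouk d u k y) /
      (real (N choose n) * M k))"
    by (rule sum.swap)
  also have "\<dots> = (\<Sum>k\<in>?K. T a k * T b k / (real (N choose n) * M k))"
    unfolding T_def sum_product sum_divide_distrib ..
  also have "\<dots> = (\<Sum>k\<in>?K. real (N choose n) * (A a * A b) ^ (N - n) *
      multinomial (d - 1) n (\<lambda>l. ?\<alpha> a l * ?\<alpha> b l) k)"
  proof (intro sum.cong refl)
    fix k assume k: "k \<in> ?K"
    have "pr (\<lambda>l. ?\<alpha> a l * ?\<alpha> b l) k = pr (?\<alpha> a) k * pr (?\<alpha> b) k"
      by (simp add: pr_def power_mult_distrib prod.distrib)
    then show "T a k * T b k / (real (N choose n) * M k) = real (N choose n) * (A a * A b) ^ (N - n) *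
      multinomial (d - 1) n (\<lambda>l. ?\<alpha> a l * ?\<alpha> b l) k"
      using Mpos[of k] Npos by (simp add: T[OF k] mult power_mult_distrib del: One_nat_def)
  qed
  also have "\<dots> = real (N choose n) * (A a * A b) ^ (N - n) * (\<Sum>l=1..d-1. ?\<alpha> a l * ?\<alpha> b l) ^ n"
    unfolding multinomial_theorem by (rule sum_distrib_left[symmetric])
  also have "(\<Sum>l=1..d-1. ?\<alpha> a l * ?\<alpha> b l) = (\<Sum>j=1..d. p j * a j * b j) - A a * A b"
    unfolding A_def by (rule orthonormal_functions_parseval[OF u d])
  finally show ?thesis .
qed

section \<open>One-dimensional Krawtchouk generating function and the full kernel series\<close>

lemma krawtchouk_gen_fun:
  fixes S T :: real
  assumes "z \<le> N"
  shows "(\<Sum>n\<le>N. real (N choose n) * krawtchouk n z N r * T ^ (N - n) * S ^ n) =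
    (T - (1 - r) / r * S) ^ z * (T + S) ^ (N - z)"
proof -
  let ?c = "- ((1 - r) / r)"
  \<comment> \<open>This is the product of the i-th and j-th terms of two binomial expansions; the
    total degree of \<open>S\<close> is i + j, and \<open>T\<close> makes everything homogeneous of
    degree \<open>N\<close>.\<close>
  let ?g = "\<lambda>i j. real (z choose i) * real ((N - z) choose j) * ?c ^ i * S ^ (i + j) * T ^ (N - (i + j))"
  have "(T - (1 - r) / r * S) ^ z = (?c * S + T) ^ z"
    by simp
  also have "\<dots> = (\<Sum>i\<le>z. real (z choose i) * (?c * S) ^ i * T ^ (z - i))"
    by (rule binomial_ring)
  finally have 1: "(T - (1 - r) / r * S) ^ z = (\<Sum>i\<le>z. real (z choose i) * (?c * S) ^ i * T ^ (z - i))" .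
  have 2: "(T + S) ^ (N - z) = (\<Sum>j\<le>N - z. real ((N - z) choose j) * S ^ j * T ^ (N - z - j))"
    by (subst add.commute) (simp add: binomial_ring)
  have "(T - (1 - r) / r * S) ^ z * (T + S) ^ (N - z) = (\<Sum>(i, j)\<in>{..z} \<times> {..N - z}. ?g i j)"
    unfolding 1 2 sum_product sum.cartesian_product
  proof (intro sum.cong refl)
    fix x assume "x \<in> {..z} \<times> {..N - z}"
    then obtain i j where x: "x = (i, j)" and ij: "i \<in> {..z}" "j \<in> {..N - z}"
      by auto
    then have "N - (i + j) = (z - i) + (N - z - j)"
      using assms by simp
    moreover have "(?c * S) ^ i = ?c ^ i * S ^ i"
      by (rule power_mult_distrib)
    ultimately show "(case x of (i, j) \<Rightarrow> real (z choose i) * (?c * S) ^ i * T ^ (z - i) *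
        (real ((N - z) choose j) * S ^ j * T ^ (N - z - j))) = (case x of (i, j) \<Rightarrow> ?g i j)"
      by (simp only: x prod.case power_add mult_ac)
  qed
  \<comment> \<open>The rectangle lies in this triangle since \<open>z \<le> N\<close>; the pairs
    added have i > z or j > N - z, where a binomial coefficient is 0. The triangle can then be
    summed along n = i + j.\<close>
  also have "\<dots> = (\<Sum>(i, j)\<in>{(i, j). i + j \<le> N}. ?g i j)"
  proof (rule sum.mono_neutral_left)
    have "{(i, j). i + j \<le> N} \<subseteq> {..N} \<times> {..N}"
      by auto
    then show "finite {(i, j). i + j \<le> N}"
      by (rule finite_subset) simp
  qed (use assms in \<open>auto simp: not_le\<close>)
  also have "\<dots> = (\<Sum>n\<le>N. \<Sum>i\<le>n. ?g i (n - i))"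
    by (rule sum.triangle_reindex_eq)
  also have "\<dots> = (\<Sum>n\<le>N. real (N choose n) * krawtchouk n z N r * T ^ (N - n) * S ^ n)"
  proof (intro sum.cong refl)
    fix n assume "n \<in> {..N}"
    then have "real (N choose n) * krawtchouk n z N r =
        (\<Sum>i\<le>n. ?c ^ i * real (z choose i) * real ((N - z) choose (n - i)))"
      by (simp add: krawtchouk_def atLeast0AtMost)
    then show "(\<Sum>i\<le>n. ?g i (n - i)) = real (N choose n) * krawtchouk n z N r * T ^ (N - n) * S ^ n"
      by (simp add: sum_distrib_left sum_distrib_right mult_ac)
  qed
  finally show ?thesis ..
qed

text \<open>Linear combination of the single-kernel generating functions. The leading 1 contributes
  (A B)^N, which is the n = 0 term with coefficient 1.\<close>

lemma kernel_gen_fun: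
  assumes u: "orthonormal_functions d p u" and d: "d \<ge> 1"
  defines "A \<equiv> \<lambda>a. \<Sum>j=1..d. p j * a j"
  shows "(\<Sum>x\<in>weak_compositions d N. \<Sum>y\<in>weak_compositions d N.
      multinomial d N p x * multinomial d N p y * (1 + (\<Sum>n=1..N. \<rho> n * kernel_poly d N p u n x y)) *
      (\<Prod>j=1..d. a j ^ Poly_Mapping.lookup x j) * (\<Prod>j=1..d. b j ^ Poly_Mapping.lookup y j)) =
    (\<Sum>n\<le>N. (if n = 0 then 1 else \<rho> n) * real (N choose n) * (A a * A b) ^ (N - n) *
      ((\<Sum>j=1..d. p j * a j * b j) - A a * A b) ^ n)" (is "?lhs = _")
proof -
  let ?W = "weak_compositions d N"
  define f where "f a x = multinomial d N p x * (\<Prod>j=1..d. a j ^ Poly_Mapping.lookup x j)" for a x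
  let ?G = "\<lambda>n. real (N choose n) * (A a * A b) ^ (N - n) * ((\<Sum>j=1..d. p j * a j * b j) - A a * A b) ^ n"
  have "?lhs = (\<Sum>x\<in>?W. \<Sum>y\<in>?W. f a x * f b y +
      (\<Sum>n=1..N. \<rho> n * (f a x * f b y * kernel_poly d N p u n x y)))"
    by (intro sum.cong refl) (simp add: f_def distrib_left distrib_right sum_distrib_left sum_distrib_right mult_ac)
  also have "\<dots> = (\<Sum>x\<in>?W. f a x) * (\<Sum>y\<in>?W. f b y) +
      (\<Sum>x\<in>?W. \<Sum>y\<in>?W. \<Sum>n=1..N. \<rho> n * (f a x * f b y * kernel_poly d N p u n x y))"
    by (simp add: sum.distrib sum_product)
  also have "(\<Sum>x\<in>?W. \<Sum>y\<in>?W. \<Sum>n=1..N. \<rho> n * (f a x * f b y * kernel_poly d N p u n x y)) =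
      (\<Sum>x\<in>?W. \<Sum>n=1..N. \<Sum>y\<in>?W. \<rho> n * (f a x * f b y * kernel_poly d N p u n x y))"
    by (intro sum.cong refl sum.swap)
  also have "\<dots> = (\<Sum>n=1..N. \<Sum>x\<in>?W. \<Sum>y\<in>?W. \<rho> n * (f a x * f b y * kernel_poly d N p u n x y))"
    by (rule sum.swap)
  also have "\<dots> = (\<Sum>n=1..N. \<rho> n * ?G n)"
  proof (intro sum.cong refl)
    fix n assume "n \<in> {1..N}"
    then have n: "n \<le> N" by simp
    have "(\<Sum>x\<in>?W. \<Sum>y\<in>?W. f a x * f b y * kernel_poly d N p u n x y) = ?G n"
      using kernel_poly_gen_fun[OF u d n, of a b] unfolding A_def f_def by (simp only: mult_ac)
    then show "(\<Sum>x\<in>?W. \<Sum>y\<in>?W. \<rho> n * (f a x * f b y * kernel_poly d N p u n x y)) = \<rho> n * ?G n"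
      by (simp only: sum_distrib_left[symmetric])
  qed
  also have "(\<Sum>x\<in>?W. f a x) * (\<Sum>y\<in>?W. f b y) = (A a * A b) ^ N"
    unfolding f_def multinomial_gen_fun A_def by (simp add: power_mult_distrib)
  also have "(A a * A b) ^ N + (\<Sum>n=1..N. \<rho> n * ?G n) = (\<Sum>n\<le>N. (if n = 0 then 1 else \<rho> n) * ?G n)"
  proof -
    have "{..N} = insert 0 {1..N}" by auto
    then show ?thesis by simp
  qed
  finally show ?thesis
    by (simp add: mult.assoc)
qed

section \<open>The two implications, in terms of weights on 0, ..., N\<close>

lemma krawtchouk_mixture_nonneg:
  assumes u: "orthonormal_functions d p u" and d: "d \<ge> 1"
    and p: "\<And>j. j \<in> {1..d} \<Longrightarrow> p j > 0"
    and r: "r > 0" "\<And>j. j \<in> {1..d} \<Longrightarrow> 1 - p j \<le> r"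
    and c: "\<And>z. c z \<ge> 0" "(\<Sum>z\<le>N. c z) = 1"
    and \<rho>: "\<And>n. n \<in> {1..N} \<Longrightarrow> \<rho> n = (\<Sum>z\<le>N. c z * krawtchouk n z N r)"
    and xy: "x \<in> weak_compositions d N" "y \<in> weak_compositions d N"
  shows "multinomial d N p x * multinomial d N p y *
    (1 + (\<Sum>n=1..N. \<rho> n * kernel_poly d N p u n x y)) \<ge> 0"
proof -
  let ?W = "weak_compositions d N"
  let ?e = "\<lambda>i. Poly_Mapping.single i (1::nat)"
  define F where "F x y = multinomial d N p x * multinomial d N p y *
    (1 + (\<Sum>n=1..N. \<rho> n * kernel_poly d N p u n x y))" for x y
  \<comment> \<open>\<open>s i j\<close> is the coefficient of a_i b_j in (A B - (1-r) C) / r. Thus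
    \<open>L1\<close> is that bilinear form, \<open>L2\<close> is C, and \<open>f\<close> is the
    mixture of their products.\<close>
  define s where "s i j = (p i * p j - (if i = j then (1 - r) * p i else 0)) / r" for i j
  define L1 where "L1 = (\<Sum>i=1..d. \<Sum>j=1..d. Poly_Mapping.single (?e i, ?e j) (s i j))"
  define L2 where "L2 = (\<Sum>i=1..d. Poly_Mapping.single (?e i, ?e i) (p i))"
  define f where "f = (\<Sum>z\<le>N. Poly_Mapping.single 0 (c z) * (L1 ^ z * L2 ^ (N - z)))"
  define g where "g = (\<Sum>x\<in>?W. \<Sum>y\<in>?W. Poly_Mapping.single (x, y) (F x y))"
  have "g = f"
  proof (rule eval_pm_pair_eqI)
    fix a b :: "nat \<Rightarrow> real"
    define A where "A a = (\<Sum>j=1..d. p j * a j)" for a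
    define C where "C = (\<Sum>j=1..d. p j * a j * b j)"
    define \<psi> where "\<psi> = (\<lambda>(x, y). monom_val a x * monom_val b y)"
    have "(\<Sum>i=1..d. \<Sum>j=1..d. s i j * (a i * b j)) =
        (\<Sum>i=1..d. \<Sum>j=1..d. (p i * a i) * (p j * b j) / r - (if i = j then (1 - r) * (p i * a i * b i) / r else 0))"
      by (intro sum.cong refl) (simp add: s_def diff_divide_distrib algebra_simps)
    also have "\<dots> = (A a * A b - (1 - r) * C) / r"
      unfolding A_def C_def sum_product
      by (simp add: sum_subtractf sum_divide_distrib diff_divide_distrib sum_distrib_left)
    finally have L1: "eval_pm \<psi> L1 = (A a * A b - (1 - r) * C) / r"
      by (simp add: L1_def eval_pm_sum \<psi>_def)
    have L2: "eval_pm \<psi> L2 = C"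
      by (simp add: L2_def eval_pm_sum \<psi>_def C_def mult_ac)
    have f: "eval_pm \<psi> f = (\<Sum>z\<le>N. c z * (eval_pm \<psi> L1 ^ z * eval_pm \<psi> L2 ^ (N - z)))"
      unfolding f_def \<psi>_def
      by (simp add: eval_pm_sum monom_pair.eval_pm_mult monom_pair.eval_pm_power zero_prod_def)
    \<comment> \<open>The case n = 0 holds because Q_0 = 1 and the weights have total mass
      1.\<close>
    have mix: "(if n = 0 then 1 else \<rho> n) = (\<Sum>z\<le>N. c z * krawtchouk n z N r)" if "n \<le> N" for n
      using that \<rho>[of n] c(2) by (auto simp: krawtchouk_def)
    have "eval_pm \<psi> g = (\<Sum>x\<in>?W. \<Sum>y\<in>?W. F x y *
      (\<Prod>j=1..d. a j ^ Poly_Mapping.lookup x j) * (\<Prod>j=1..d. b j ^ Poly_Mapping.lookup y j))"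
      unfolding g_def eval_pm_sum eval_pm_single \<psi>_def
      by (intro sum.cong refl) (simp add: monom_val_weak_composition)
    also have "\<dots> = (\<Sum>n\<le>N. (if n = 0 then 1 else \<rho> n) * real (N choose n) *
        (A a * A b) ^ (N - n) * (C - A a * A b) ^ n)"
      unfolding F_def A_def C_def by (rule kernel_gen_fun[OF u d])
    also have "\<dots> = (\<Sum>n\<le>N. \<Sum>z\<le>N. c z * (real (N choose n) * krawtchouk n z N r *
        (A a * A b) ^ (N - n) * (C - A a * A b) ^ n))"
      by (intro sum.cong refl) (simp add: mix sum_distrib_left sum_distrib_right mult_ac)
    also have "\<dots> = (\<Sum>z\<le>N. \<Sum>n\<le>N. c z * (real (N choose n) * krawtchouk n z N r *
        (A a * A b) ^ (N - n) * (C - A a * A b) ^ n))"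
      by (rule sum.swap)
    \<comment> \<open>The Krawtchouk generating function at T = A B and S = C - A B, so that T + S =
      C.\<close>
    also have "\<dots> = (\<Sum>z\<le>N. c z * ((A a * A b - (1 - r) / r * (C - A a * A b)) ^ z * C ^ (N - z)))"
      unfolding sum_distrib_left[symmetric]
      by (intro sum.cong refl) (simp add: krawtchouk_gen_fun)
    also have "A a * A b - (1 - r) / r * (C - A a * A b) = (A a * A b - (1 - r) * C) / r"
      using r(1) by (simp add: field_simps)
    also have "(\<Sum>z\<le>N. c z * (((A a * A b - (1 - r) * C) / r) ^ z * C ^ (N - z))) = eval_pm \<psi> f"
      unfolding f L1 L2 ..
    finally show "eval_pm (\<lambda>(x, y). monom_val a x * monom_val b y) g =
        eval_pm (\<lambda>(x, y). monom_val a x * monom_val b y) f"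
      by (simp add: \<psi>_def)
  qed
  \<comment> \<open>Only the diagonal can be critical: there the sign is that of p_i - (1 - r),
    which is where the bound on \<open>r\<close> enters.\<close>
  have s: "s i j \<ge> 0" if ij: "i \<in> {1..d}" "j \<in> {1..d}" for i j
  proof (cases "i = j")
    case True
    have "p i * (p i - (1 - r)) \<ge> 0"
      using p[OF ij(1)] r(2)[OF ij(1)] by simp
    with True r(1) show ?thesis
      by (simp add: s_def algebra_simps)
  next
    case False
    with ij p[of i] p[of j] r(1) show ?thesis
      by (simp add: s_def)
  qed
  have "Poly_Mapping.lookup L1 k \<ge> 0" "Poly_Mapping.lookup L2 k \<ge> 0" for k
    unfolding L1_def L2_def lookup_sum lookup_single
    using s p by (auto intro!: sum_nonneg simp: when_def less_imp_le)
  then have "Poly_Mapping.lookup f (x, y) \<ge> 0"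
    unfolding f_def lookup_sum lookup_single_zero_mult
    by (intro sum_nonneg mult_nonneg_nonneg c lookup_mult_nonneg lookup_power_nonneg)
  moreover have "Poly_Mapping.lookup g (x, y) = F x y"
  proof -
    have "Poly_Mapping.lookup g (x, y) = (\<Sum>x'\<in>?W. \<Sum>y'\<in>?W. if y' = y then if x' = x then F x y else 0 else 0)"
      unfolding g_def lookup_sum lookup_single by (intro sum.cong refl) (auto simp: when_def)
    then show ?thesis
      using xy by (simp add: finite_weak_compositions)
  qed
  ultimately show ?thesis
    using \<open>g = f\<close> by (simp add: F_def)
qed

text \<open>Taking a = e_i keeps a single x, and giving b one value at i and another elsewhere
  retains only y_i from y. The nonnegative coefficients thus collapse to weights on 0, ..., N, and
  normalising B = 1 leaves an identity of polynomials in one variable. The bound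
  \<open>p i < 1\<close> makes r = 1 - p_i positive.\<close>

lemma nonneg_imp_krawtchouk_mixture:
  assumes u: "orthonormal_functions d p u"
    and p: "\<And>j. j \<in> {1..d} \<Longrightarrow> p j > 0" "(\<Sum>j=1..d. p j) = 1"
    and i: "i \<in> {1..d}" "p i < 1"
    and nonneg: "\<And>x y. x \<in> weak_compositions d N \<Longrightarrow> y \<in> weak_compositions d N \<Longrightarrow>
      multinomial d N p x * multinomial d N p y *
        (1 + (\<Sum>n=1..N. \<rho> n * kernel_poly d N p u n x y)) \<ge> 0"
  obtains c where "\<And>z. c z \<ge> 0" "(\<Sum>z\<le>N. c z) = 1"
    "\<And>n. n \<in> {1..N} \<Longrightarrow> \<rho> n = (\<Sum>z\<le>N. c z * krawtchouk n z N (1 - p i))"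
proof -
  let ?W = "weak_compositions d N"
  define F where "F x y = multinomial d N p x * multinomial d N p y *
    (1 + (\<Sum>n=1..N. \<rho> n * kernel_poly d N p u n x y))" for x y
  define r where "r = 1 - p i"
  have r: "r > 0"
    using i by (simp add: r_def)
  have pi: "p i > 0"
    using p i by simp
  \<comment> \<open>With 0^0 = 1, \<open>m x\<close> is 1 at x = N e_i and 0 at every other
    composition in \<open>?W\<close>.\<close>
  define a where "a j = (if j = i then 1 else 0 :: real)" for j
  define m where "m x = (\<Prod>j=1..d. a j ^ Poly_Mapping.lookup x j)" for x
  \<comment> \<open>The coefficients are grouped by the number of units of y outside coordinate i;
    division by p_i^N brings the total mass to 1.\<close>
  define c where "c z = (\<Sum>y\<in>{y\<in>?W. N - Poly_Mapping.lookup y i = z}. \<Sum>x\<in>?W. F x y * m x) / p i ^ N" for z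
  define \<rho>' where "\<rho>' n = (if n = 0 then 1 else \<rho> n)" for n
  have "m x \<ge> 0" for x
    by (simp add: m_def a_def prod_nonneg)
  moreover have "F x y \<ge> 0" if "x \<in> ?W" "y \<in> ?W" for x y
    unfolding F_def using that by (rule nonneg)
  ultimately have c_nonneg: "c z \<ge> 0" for z
    unfolding c_def using pi by (intro divide_nonneg_nonneg sum_nonneg mult_nonneg_nonneg) auto
  have key: "(\<Sum>z\<le>N. c z * ((1 - (1 - r) / r * S) ^ z * (1 + S) ^ (N - z))) =
    (\<Sum>n\<le>N. \<rho>' n * real (N choose n) * S ^ n)" for S
  proof -
    \<comment> \<open>\<open>D\<close> and \<open>E\<close> are the two bases of the Krawtchouk
      generating function at T = 1. They satisfy p_i E + r D = 1 for every \<open>S\<close>, because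
      p_i = 1 - r.\<close>
    define D where "D = 1 - (1 - r) / r * S"
    define E where "E = 1 + S"
    define b where "b j = (if j = i then E else D)" for j
    have split: "sum h {1..d} = h i + sum h ({1..d} - {i})" for h :: "nat \<Rightarrow> real"
      using i by (simp add: sum.remove)
    have A: "(\<Sum>j=1..d. p j * a j) = p i"
      unfolding split by (simp add: a_def)
    have C: "(\<Sum>j=1..d. p j * a j * b j) = p i * E"
      unfolding split by (simp add: a_def b_def)
    have "sum p ({1..d} - {i}) = r"
      using p(2) unfolding split r_def by simp
    then have "(\<Sum>j=1..d. p j * b j) = p i * E + r * D"
      unfolding split by (simp add: b_def sum_distrib_right[symmetric])
    also have "\<dots> = 1"
      using r by (simp add: D_def E_def r_def field_simps)
    finally have B: "(\<Sum>j=1..d. p j * b j) = 1" .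
    \<comment> \<open>The exponent of \<open>E\<close> is just y_i, written as N - z with z = N -
      y_i to match the grouping in \<open>c\<close>.\<close>
    have b: "(\<Prod>j=1..d. b j ^ Poly_Mapping.lookup y j) =
        D ^ (N - Poly_Mapping.lookup y i) * E ^ (N - (N - Poly_Mapping.lookup y i))" if y: "y \<in> ?W" for y
    proof -
      let ?y = "Poly_Mapping.lookup y"
      have "sum ?y {1..d} = ?y i + sum ?y ({1..d} - {i})"
        using i by (simp add: sum.remove)
      then have N: "N = ?y i + sum ?y ({1..d} - {i})"
        using y by (simp add: weak_compositions_def)
      have "(\<Prod>j=1..d. b j ^ ?y j) = E ^ ?y i * (\<Prod>j\<in>{1..d} - {i}. b j ^ ?y j)"
        using i by (simp add: prod.remove b_def)
      also have "(\<Prod>j\<in>{1..d} - {i}. b j ^ ?y j) = D ^ sum ?y ({1..d} - {i})"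
        by (simp add: b_def power_sum)
      finally show ?thesis
        using N by simp
    qed
    have "p i ^ N * (\<Sum>z\<le>N. c z * (D ^ z * E ^ (N - z))) =
        (\<Sum>z\<le>N. \<Sum>y\<in>{y\<in>?W. N - Poly_Mapping.lookup y i = z}. \<Sum>x\<in>?W. F x y * m x * (D ^ z * E ^ (N - z)))"
      using pi by (simp add: c_def sum_distrib_left sum_distrib_right sum_divide_distrib)
    also have "\<dots> = (\<Sum>z\<le>N. \<Sum>y\<in>{y\<in>?W. N - Poly_Mapping.lookup y i = z}. \<Sum>x\<in>?W.
        F x y * m x * (\<Prod>j=1..d. b j ^ Poly_Mapping.lookup y j))"
      using b by (intro sum.cong refl) auto
    also have "\<dots> = (\<Sum>y\<in>?W. \<Sum>x\<in>?W. F x y * m x * (\<Prod>j=1..d. b j ^ Poly_Mapping.lookup y j))"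
      by (rule sum.group) (auto simp: finite_weak_compositions)
    also have "\<dots> = (\<Sum>x\<in>?W. \<Sum>y\<in>?W. F x y * m x * (\<Prod>j=1..d. b j ^ Poly_Mapping.lookup y j))"
      by (rule sum.swap)
    \<comment> \<open>Here A = p_i, B = 1 and C = p_i E, so C - A B = p_i S and every term carries
      the factor p_i^N.\<close>
    also have "\<dots> = (\<Sum>n\<le>N. \<rho>' n * real (N choose n) * p i ^ (N - n) * (p i * E - p i) ^ n)"
      unfolding F_def m_def \<rho>'_def using i p(1)
      by (subst kernel_gen_fun[OF u]) (auto simp only: A B C mult_1_right atLeastAtMost_iff)
    also have "\<dots> = (\<Sum>n\<le>N. p i ^ N * (\<rho>' n * real (N choose n) * S ^ n))"
    proof (intro sum.cong refl)
      fix n assume "n \<in> {..N}"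
      then have "p i ^ N = p i ^ (N - n) * p i ^ n"
        by (simp flip: power_add)
      moreover have "p i * E - p i = p i * S"
        by (simp add: E_def algebra_simps)
      ultimately show "\<rho>' n * real (N choose n) * p i ^ (N - n) * (p i * E - p i) ^ n =
          p i ^ N * (\<rho>' n * real (N choose n) * S ^ n)"
        by (simp add: power_mult_distrib)
    qed
    finally show ?thesis
      using pi by (simp add: D_def E_def flip: sum_distrib_left)
  qed
  have "(\<Sum>n\<le>N. (real (N choose n) * (\<Sum>z\<le>N. c z * krawtchouk n z N r)) * S ^ n) =
      (\<Sum>n\<le>N. (\<rho>' n * real (N choose n)) * S ^ n)" for S
  proof -
    have "(\<Sum>n\<le>N. (real (N choose n) * (\<Sum>z\<le>N. c z * krawtchouk n z N r)) * S ^ n) =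
        (\<Sum>n\<le>N. \<Sum>z\<le>N. c z * (real (N choose n) * krawtchouk n z N r * 1 ^ (N - n) * S ^ n))"
      by (simp add: sum_distrib_left sum_distrib_right mult_ac)
    also have "\<dots> = (\<Sum>z\<le>N. \<Sum>n\<le>N. c z * (real (N choose n) * krawtchouk n z N r * 1 ^ (N - n) * S ^ n))"
      by (rule sum.swap)
    also have "\<dots> = (\<Sum>z\<le>N. c z * ((1 - (1 - r) / r * S) ^ z * (1 + S) ^ (N - z)))"
      unfolding sum_distrib_left[symmetric]
      by (intro sum.cong refl arg_cong2[of _ _ _ _ times] krawtchouk_gen_fun) auto
    finally show ?thesis
      by (simp only: key)
  qed
  \<comment> \<open>Polynomials in \<open>S\<close> equal at all reals have equal coefficients; N
    choose n is nonzero for n at most N and cancels.\<close>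
  then have coeff: "\<rho>' n = (\<Sum>z\<le>N. c z * krawtchouk n z N r)" if "n \<le> N" for n
    using that polyfun_eq_coeffs[of "\<lambda>n. real (N choose n) * (\<Sum>z\<le>N. c z * krawtchouk n z N r)" N
        "\<lambda>n. \<rho>' n * real (N choose n)"] by auto
  show thesis
  proof (rule that[OF c_nonneg])
    \<comment> \<open>The comparison at n = 0, where Q_0 = 1 and \<open>\<rho>' 0 = 1\<close>, gives
      the total mass.\<close>
    show "(\<Sum>z\<le>N. c z) = 1"
      using coeff[of 0] by (simp add: krawtchouk_def \<rho>'_def)
    show "\<rho> n = (\<Sum>z\<le>N. c z * krawtchouk n z N (1 - p i))" if "n \<in> {1..N}" for n
      using coeff[of n] that by (auto simp: \<rho>'_def r_def)
  qed
qed

section \<open>Passage to random variables and the equivalence\<close>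

lemma pmf_of_weights:
  fixes c :: "nat \<Rightarrow> real"
  assumes "\<And>z. c z \<ge> 0" "(\<Sum>z\<le>N. c z) = 1"
  shows "\<exists>Z. set_pmf Z \<subseteq> {..N} \<and> (\<forall>z\<le>N. pmf Z z = c z)"
proof -
  \<comment> \<open>The weights are cut off above \<open>N\<close>, where \<open>c\<close> may be
    nonzero, so that the total mass over all naturals is 1.\<close>
  define f where "f z = (if z \<le> N then c z else 0)" for z
  have "(\<integral>\<^sup>+ z. ennreal (f z) \<partial>count_space UNIV) = (\<Sum>z\<le>N. ennreal (f z))"
    by (rule nn_integral_count_space') (auto simp: f_def)
  also have "\<dots> = 1"
    using assms by (simp add: f_def)
  finally have pmf: "pmf (embed_pmf f) z = f z" for z
    using assms(1) by (intro pmf_embed_pmf) (auto simp: f_def)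
  have "set_pmf (embed_pmf f) \<subseteq> {..N}"
    by (auto simp: set_pmf_eq pmf f_def split: if_splits)
  moreover have "\<forall>z\<le>N. pmf (embed_pmf f) z = c z"
    by (simp add: pmf f_def)
  ultimately show ?thesis
    by blast
qed

theorem theorem6:
  fixes N d :: nat and p \<rho> :: "nat \<Rightarrow> real" and u :: "nat \<Rightarrow> nat \<Rightarrow> real"
  assumes "N \<ge> 1" and "d \<ge> 2"
    and "\<And>j. j \<in> {1..d} \<Longrightarrow> p j > 0" and "(\<Sum>j=1..d. p j) = 1"
    and "orthonormal_functions d p u"
  shows "(\<forall>x\<in>weak_compositions d N. \<forall>y\<in>weak_compositions d N.
            multinomial d N p x * multinomial d N p y *
              (1 + (\<Sum>n=1..N. \<rho> n * kernel_poly d N p u n x y)) \<ge> 0)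
         \<longleftrightarrow>
         (\<exists>(r::real) (Z::nat pmf).
            1 - (MIN j\<in>{1..d}. p j) \<le> r \<and> r \<le> 1 \<and>
            set_pmf Z \<subseteq> {0..N} \<and>
            (\<forall>n\<in>{1..N}. \<rho> n = measure_pmf.expectation Z (\<lambda>z. krawtchouk n z N r)))"
    (is "?nonneg \<longleftrightarrow> ?mixture")
proof -
  have "(MIN j\<in>{1..d}. p j) \<in> p ` {1..d}"
    using \<open>d \<ge> 2\<close> by (intro Min_in) auto
  then obtain i where i: "i \<in> {1..d}" "(MIN j\<in>{1..d}. p j) = p i"
    by auto
  have min: "p i \<le> p j" if "j \<in> {1..d}" for j
    using that by (simp flip: i(2))
  \<comment> \<open>Since d is at least 2, some other coordinate has positive mass, which forces
    \<open>p i < 1\<close>.\<close>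
  have "{1..d} - {i} \<noteq> {}"
  proof
    assume "{1..d} - {i} = {}"
    then have "{1..d} \<subseteq> {i}" by simp
    then have "card {1..d} \<le> card {i}" by (intro card_mono) auto
    with \<open>d \<ge> 2\<close> show False by simp
  qed
  then have "sum p ({1..d} - {i}) > 0"
    using assms(3) by (intro sum_pos) auto
  then have less: "p i < 1"
    using assms(4) i(1) by (simp add: sum.remove)
  have mean: "measure_pmf.expectation Z h = (\<Sum>z\<le>N. pmf Z z * h z)"
    if "set_pmf Z \<subseteq> {..N}" for Z :: "nat pmf" and h :: "nat \<Rightarrow> real"
    using that by (subst integral_measure_pmf_real[of "{..N}"]) (auto simp: mult.commute)
  show ?thesis
  proof
    assume nonneg: ?nonneg
    show ?mixture
    \<comment> \<open>The witness is the smallest admissible parameter, r = 1 - p_i with p_i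
      minimal.\<close>
    proof (rule nonneg_imp_krawtchouk_mixture[OF assms(5,3,4) i(1) less])
      show "multinomial d N p x * multinomial d N p y *
          (1 + (\<Sum>n=1..N. \<rho> n * kernel_poly d N p u n x y)) \<ge> 0"
        if "x \<in> weak_compositions d N" "y \<in> weak_compositions d N" for x y
        using nonneg that by blast
    next
      fix c :: "nat \<Rightarrow> real"
      assume c: "\<And>z. c z \<ge> 0" "(\<Sum>z\<le>N. c z) = 1"
        "\<And>n. n \<in> {1..N} \<Longrightarrow> \<rho> n = (\<Sum>z\<le>N. c z * krawtchouk n z N (1 - p i))"
      obtain Z where Z: "set_pmf Z \<subseteq> {..N}" "\<forall>z\<le>N. pmf Z z = c z"
        using pmf_of_weights[OF c(1,2)] by blast
      have "\<rho> n = measure_pmf.expectation Z (\<lambda>z. krawtchouk n z N (1 - p i))" if "n \<in> {1..N}" for n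
        unfolding mean[OF Z(1)] c(3)[OF that] using Z(2) by (intro sum.cong) auto
      moreover have "1 - p i \<le> 1"
        using assms(3)[OF i(1)] by simp
      ultimately show ?mixture
        unfolding i(2) atLeast0AtMost using Z(1) by blast
    qed
  next
    assume ?mixture
    then obtain r Z where r: "1 - p i \<le> r" "r \<le> 1" and Z: "set_pmf Z \<subseteq> {..N}"
      and \<rho>: "\<And>n. n \<in> {1..N} \<Longrightarrow> \<rho> n = measure_pmf.expectation Z (\<lambda>z. krawtchouk n z N r)"
      unfolding i(2) atLeast0AtMost by blast
    show ?nonneg
    \<comment> \<open>Minimality of p_i gives 1 - p_j \<le> 1 - p_i \<le> r for all j, and
      \<open>p i < 1\<close> gives r > 0.\<close>
    proof (intro ballI krawtchouk_mixture_nonneg[where r = r and c = "pmf Z"])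
      show "(\<Sum>z\<le>N. pmf Z z) = 1"
        using mean[OF Z, of "\<lambda>_. 1"] by simp
      show "1 - p j \<le> r" if "j \<in> {1..d}" for j
        using r(1) min[OF that] by simp
      show "\<rho> n = (\<Sum>z\<le>N. pmf Z z * krawtchouk n z N r)" if "n \<in> {1..N}" for n
        unfolding \<rho>[OF that] by (rule mean[OF Z])
    qed (use assms(2,3,5) r less in simp_all)
  qed
qed

end
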